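(* The matrices $\mathbf a_N$, $\mathbf b_N$ implement the shift $N\mapsto N+1$ in the windows of quasi-polynomials: $$\mathbf a_N(x)\Psi_N(x)=\Psi_{N+1}(x)\quad(N\ge d_2),\qquad \mathbf b_N(y)\Phi_N(y)=\Phi_{N+1}(y)\quad(N\ge d_1),$$ and in general, for $j\ge1$, $$\Psi_{N+j}=\mathbf a_{N+j-1}\cdots\mathbf a_N\Psi_N,\qquad \Phi_{N+j}=\mathbf b_{N+j-1}\cdots\mathbf b_N\Phi_N.$$
   Context: Fix integers $d_1,d_2\ge1$ and $V_1(x)=\sum_{K=1}^{d_1+1}\frac{u_K}{K}x^K$, $V_2(y)=\sum_{J=1}^{d_2+1}\frac{v_J}{J}y^J$ with $u_{d_1+1}\ne0$, $v_{d_2+1}\ne0$, and contours $\Gamma_x,\Gamma_y$ such that all integrals below converge and integrations by parts produce no boundary terms. Assume there are monic polynomials $\pi_n,\sigma_n$ of degree $n$ ($n\ge0$) with $\int_{\Gamma_x}\int_{\Gamma_y}\pi_n(x)\sigma_m(y)e^{-V_1(x)-V_2(y)+xy}\,dy\,dx=h_n\delta_{nm}$, $h_n\neq0$. Fix $\sqrt{h_n}$ and put $\psi_n(x)=\pi_n(x)e^{-V_1(x)}/\sqrt{h_n}$, $\phi_n(y)=\sigma_n(y)e^{-V_2(y)}/\sqrt{h_n}$. There are unique numbers $\alpha_j(n)$ ($0\le j\le d_2$), $\beta_j(n)$ ($0\le j\le d_1$), zero for $n<j$, such that with $\gamma(n)=\sqrt{h_{n+1}}/\sqrt{h_n}$,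 for all $n\ge0$ (terms with negative index omitted): $x\psi_n=\gamma(n)\psi_{n+1}+\sum_{j=0}^{d_2}\alpha_j(n)\psi_{n-j}$ and $y\phi_n=\gamma(n)\phi_{n+1}+\sum_{j=0}^{d_1}\beta_j(n)\phi_{n-j}$. Windows: $\Psi_N=[\psi_{N-d_2},\dots,\psi_N]^t$ ($N\ge d_2$), $\Phi_N=[\phi_{N-d_1},\dots,\phi_N]^t$ ($N\ge d_1$). $\mathbf a_N(x)$ ($N\ge d_2$) is the $(d_2+1)\times(d_2+1)$ matrix with $1$'s on the first superdiagonal, last row $\frac1{\gamma(N)}(-\alpha_{d_2}(N),\dots,-\alpha_1(N),x-\alpha_0(N))$, other entries $0$. $\mathbf b_N(y)$ ($N\ge d_1$) is the $(d_1+1)\times(d_1+1)$ matrix with $1$'s on the first superdiagonal, last row $\frac1{\gamma(N)}(-\beta_{d_1}(N),\dots,-\beta_1(N),y-\beta_0(N))$, other entries $0$. *)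

theory Defs
  imports
    "HOL-Analysis.Analysis"
    "Jordan_Normal_Form.Matrix"
begin

text \<open>A contour is parametrised over the whole real line, so that it may go to infinity at
  both ends; a contour over any other open interval is reparametrised to this form.
  The integrals are gauge (Henstock--Kurzweil) integrals, hence conditionally convergent
  improper integrals are allowed.\<close>

definition contour :: "(real \<Rightarrow> complex) \<Rightarrow> bool" where
  "contour g \<longleftrightarrow> (\<forall>a b. g piecewise_C1_differentiable_on {a..b})"

definition contour_int :: "(real \<Rightarrow> complex) \<Rightarrow> (complex \<Rightarrow> complex) \<Rightarrow> complex" where
  "contour_int g f = integral UNIV (\<lambda>t. f (g t) * vector_derivative g (at t))"

definition contour_int_converges :: "(real \<Rightarrow> complex) \<Rightarrow> (complex \<Rightarrow> complex) \<Rightarrow> bool" where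
  "contour_int_converges g f \<longleftrightarrow> (\<lambda>t. f (g t) * vector_derivative g (at t)) integrable_on UNIV"

text \<open>The iterated integral of \<open>f x y\<close>, first \<open>dy\<close> along \<open>gy\<close>, then \<open>dx\<close> along \<open>gx\<close>.\<close>

definition double_int ::
  "(real \<Rightarrow> complex) \<Rightarrow> (real \<Rightarrow> complex) \<Rightarrow> (complex \<Rightarrow> complex \<Rightarrow> complex) \<Rightarrow> complex" where
  "double_int gx gy f = contour_int gx (\<lambda>x. contour_int gy (\<lambda>y. f x y))"

definition double_int_converges ::
  "(real \<Rightarrow> complex) \<Rightarrow> (real \<Rightarrow> complex) \<Rightarrow> (complex \<Rightarrow> complex \<Rightarrow> complex) \<Rightarrow> bool" where
  "double_int_converges gx gy f \<longleftrightarrow>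
     (\<forall>x \<in> range gx. contour_int_converges gy (\<lambda>y. f x y)) \<and>
     contour_int_converges gx (\<lambda>x. contour_int gy (\<lambda>y. f x y))"

definition potential :: "nat \<Rightarrow> (nat \<Rightarrow> complex) \<Rightarrow> complex \<Rightarrow> complex" where
  "potential d c z = (\<Sum>K = 1..d + 1. c K / of_nat K * z ^ K)"

definition weight ::
  "nat \<Rightarrow> nat \<Rightarrow> (nat \<Rightarrow> complex) \<Rightarrow> (nat \<Rightarrow> complex) \<Rightarrow> complex \<Rightarrow> complex \<Rightarrow> complex" where
  "weight d1 d2 u v x y = exp (- potential d1 u x - potential d2 v y + x * y)"

text \<open>All moments converge, and partial integration of polynomials against the weight, in
  either variable, gives no boundary term: the integral of a total derivative vanishes.\<close>

definition admissible_contours ::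
  "nat \<Rightarrow> nat \<Rightarrow> (nat \<Rightarrow> complex) \<Rightarrow> (nat \<Rightarrow> complex) \<Rightarrow> (real \<Rightarrow> complex) \<Rightarrow> (real \<Rightarrow> complex) \<Rightarrow> bool"
  where
  "admissible_contours d1 d2 u v gx gy \<longleftrightarrow>
     contour gx \<and> contour gy \<and>
     (\<forall>p q :: complex poly.
        double_int_converges gx gy (\<lambda>x y. poly p x * poly q y * weight d1 d2 u v x y) \<and>
        double_int gx gy
          (\<lambda>x y. deriv (\<lambda>z. poly p z * poly q y * weight d1 d2 u v z y) x) = 0 \<and>
        double_int gx gy
          (\<lambda>x y. deriv (\<lambda>z. poly p x * poly q z * weight d1 d2 u v x z) y) = 0)"

definition monic_sequence :: "(nat \<Rightarrow> complex poly) \<Rightarrow> bool" where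
  "monic_sequence p \<longleftrightarrow> (\<forall>n. degree (p n) = n \<and> lead_coeff (p n) = 1)"

definition biorthogonal ::
  "nat \<Rightarrow> nat \<Rightarrow> (nat \<Rightarrow> complex) \<Rightarrow> (nat \<Rightarrow> complex) \<Rightarrow> (real \<Rightarrow> complex) \<Rightarrow> (real \<Rightarrow> complex) \<Rightarrow>
   (nat \<Rightarrow> complex poly) \<Rightarrow> (nat \<Rightarrow> complex poly) \<Rightarrow> (nat \<Rightarrow> complex) \<Rightarrow> bool" where
  "biorthogonal d1 d2 u v gx gy p q h \<longleftrightarrow>
     (\<forall>n m. double_int gx gy (\<lambda>x y. poly (p n) x * poly (q m) y * weight d1 d2 u v x y) =
            (if n = m then h n else 0))"

text \<open>In the following, \<open>s n\<close> is the chosen square root of \<open>h n\<close>. The definitions serve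
  both variables: the sequence in \<open>x\<close> uses the potential of degree \<open>d1 + 1\<close> but
  windows of length \<open>d2 + 1\<close>, and vice versa for the sequence in \<open>y\<close>.\<close>

definition quasi_poly ::
  "nat \<Rightarrow> (nat \<Rightarrow> complex) \<Rightarrow> (nat \<Rightarrow> complex poly) \<Rightarrow> (nat \<Rightarrow> complex) \<Rightarrow> nat \<Rightarrow> complex \<Rightarrow> complex"
  where
  "quasi_poly d c p s n z = poly (p n) z * exp (- potential d c z) / s n"

definition gamma_coeff :: "(nat \<Rightarrow> complex) \<Rightarrow> nat \<Rightarrow> complex" where
  "gamma_coeff s n = s (Suc n) / s n"

text \<open>\<open>\<alpha> j n\<close> is the coefficient written \<open>\<alpha>\<^sub>j(n)\<close>. Terms with negative index \<open>n - j\<close> are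
  omitted from the sum. For a system of quasi-polynomials, whose degrees are all distinct,
  these conditions determine \<open>\<alpha> j n\<close> for \<open>j \<le> d\<close>; values for \<open>j > d\<close> play no role.\<close>

definition recurrence_coeffs ::
  "nat \<Rightarrow> (nat \<Rightarrow> complex) \<Rightarrow> (nat \<Rightarrow> complex \<Rightarrow> complex) \<Rightarrow> (nat \<Rightarrow> nat \<Rightarrow> complex) \<Rightarrow> bool" where
  "recurrence_coeffs d s f \<alpha> \<longleftrightarrow>
     (\<forall>n. \<forall>j\<le>d. n < j \<longrightarrow> \<alpha> j n = 0) \<and>
     (\<forall>n z. z * f n z =
        gamma_coeff s n * f (Suc n) z + (\<Sum>j | j \<le> d \<and> j \<le> n. \<alpha> j n * f (n - j) z))"

text \<open>The window \<open>[f (N - d), \<dots>, f N]\<close>, meaningful for \<open>N \<ge> d\<close>.\<close>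

definition window ::
  "nat \<Rightarrow> (nat \<Rightarrow> complex \<Rightarrow> complex) \<Rightarrow> nat \<Rightarrow> complex \<Rightarrow> complex Matrix.vec" where
  "window d f N z = Matrix.vec (d + 1) (\<lambda>i. f (N - d + i) z)"

definition shift_mat ::
  "nat \<Rightarrow> (nat \<Rightarrow> complex) \<Rightarrow> (nat \<Rightarrow> nat \<Rightarrow> complex) \<Rightarrow> nat \<Rightarrow> complex \<Rightarrow> complex Matrix.mat" where
  "shift_mat d s \<alpha> N z = Matrix.mat (d + 1) (d + 1) (\<lambda>(i, k).
     if i < d then (if k = i + 1 then 1 else 0)
     else if k < d then - \<alpha> (d - k) N / gamma_coeff s N
     else (z - \<alpha> 0 N) / gamma_coeff s N)"

text \<open>The ordered product \<open>A (N + j - 1) * \<dots> * A N\<close> of \<open>m \<times> m\<close> matrices.\<close>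

primrec ladder_prod ::
  "nat \<Rightarrow> (nat \<Rightarrow> complex Matrix.mat) \<Rightarrow> nat \<Rightarrow> nat \<Rightarrow> complex Matrix.mat" where
  "ladder_prod m A N 0 = 1\<^sub>m m"
| "ladder_prod m A N (Suc j) = A (N + j) * ladder_prod m A N j"

end

theory Submission
  imports Defs
begin

text \<open>The matrix is the companion matrix of the recurrence. Solving the recurrence at
  \<open>N\<close> for \<open>f (Suc N)\<close>, which is possible because
  \<open>gamma_coeff s N\<close> is nonzero, expresses the one new entry of the next window as a
  linear combination of the entries of the current one; the other entries are only moved up by one
  place. This is \<open>shift_mat_mult_window\<close>, stated for an arbitrary sequence
  \<open>f\<close> so that it serves both variables. Iterating it and collecting the factors by
  associativity gives \<open>window_add_eq_ladder_prod\<close>.\<close>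

lemma dim_shift_mat [simp]:
  "dim_row (shift_mat d s \<alpha> N z) = d + 1" "dim_col (shift_mat d s \<alpha> N z) = d + 1"
  by (simp_all add: shift_mat_def)

lemma dim_window [simp]: "dim_vec (window d f N z) = d + 1"
  by (simp add: window_def)

lemma shift_mat_carrier: "shift_mat d s \<alpha> N z \<in> carrier_mat (d + 1) (d + 1)"
  by (rule carrier_matI) simp_all

lemma window_carrier: "window d f N z \<in> carrier_vec (d + 1)"
  by (rule carrier_vecI) simp

lemma ladder_prod_carrier:
  assumes "\<And>n. A n \<in> carrier_mat m m"
  shows "ladder_prod m A N j \<in> carrier_mat m m"
  by (induction j) (simp_all add: mult_carrier_mat[OF assms])

text \<open>The superdiagonal rows copy the next entry of the window, and the last row is the
  recurrence at \<open>N\<close> solved for \<open>f (Suc N)\<close>.\<close>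

lemma shift_mat_mult_window:
  assumes rec: "recurrence_coeffs d s f \<alpha>"
    and s: "\<And>n. s n \<noteq> 0" and N: "d \<le> N"
  shows "shift_mat d s \<alpha> N z *\<^sub>v window d f N z = window d f (Suc N) z"
proof (rule eq_vecI)
  fix i assume "i < dim_vec (window d f (Suc N) z)"
  then have i: "i \<le> d" by simp
  have entry: "vec_index (shift_mat d s \<alpha> N z *\<^sub>v window d f N z) i =
      (\<Sum>k<Suc d. (if i < d then (if k = i + 1 then 1 else 0)
        else if k < d then - \<alpha> (d - k) N / gamma_coeff s N
        else (z - \<alpha> 0 N) / gamma_coeff s N) * f (N - d + k) z)" (is "_ = ?S")
    using i by (simp add: shift_mat_def window_def scalar_prod_def lessThan_atLeast0)
  have "?S = f (Suc N - d + i) z"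
  proof (cases "i < d")
    case True
    then have "?S = (\<Sum>k<Suc d. if k = i + 1 then f (N - d + k) z else 0)"
      by (intro sum.cong) auto
    also have "\<dots> = f (N - d + (i + 1)) z"
      using True by (subst sum.delta) auto
    \<comment> \<open>Subtraction on naturals is truncated: \<open>N - d + (i + 1)\<close> equals
      \<open>Suc N - d + i\<close> only because \<open>d \<le> N\<close>.\<close>
    finally show ?thesis
      using N by (simp add: Suc_diff_le)
  next
    case False
    then have "i = d" using i by simp
    let ?g = "gamma_coeff s N"
    have g: "?g \<noteq> 0" using s by (simp add: gamma_coeff_def)
    \<comment> \<open>Since \<open>d \<le> N\<close>, no term of the recurrence has a negative
      index, so all \<open>d + 1\<close> terms are present.\<close>
    have "{j. j \<le> d \<and> j \<le> N} = {..<Suc d}" using N by auto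
    then have "z * f N z = ?g * f (Suc N) z + (\<Sum>j<Suc d. \<alpha> j N * f (N - j) z)"
      using rec unfolding recurrence_coeffs_def by auto
    \<comment> \<open>The window lists its entries by increasing index, the recurrence by decreasing
      index; put \<open>j = d - k\<close>.\<close>
    also have "(\<Sum>j<Suc d. \<alpha> j N * f (N - j) z)
        = (\<Sum>k<Suc d. \<alpha> (d - k) N * f (N - d + k) z)"
      using N by (subst sum.nat_diff_reindex [symmetric]) (auto intro!: sum.cong)
    \<comment> \<open>The term \<open>k = d\<close>, which is \<open>\<alpha> 0 N * f N z\<close>,
      is split off and joined with \<open>z * f N z\<close>.\<close>
    finally have "f (Suc N) z
        = ((z - \<alpha> 0 N) * f N z - (\<Sum>k<d. \<alpha> (d - k) N * f (N - d + k) z)) / ?g"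
      using g N by (simp add: field_simps)
    then show ?thesis
      using \<open>i = d\<close> N
      by (simp add: diff_divide_distrib sum_divide_distrib sum_negf left_diff_distrib)
  qed
  with entry i show "vec_index (shift_mat d s \<alpha> N z *\<^sub>v window d f N z) i =
      vec_index (window d f (Suc N) z) i"
    by (simp add: window_def)
qed simp

text \<open>Induction on \<open>j\<close>, starting from the empty product, the identity. The
  one-step lemma applies at \<open>N + j\<close> because \<open>d \<le> N + j\<close>, and its
  matrix enters on the left of the product.\<close>

lemma window_add_eq_ladder_prod:
  assumes rec: "recurrence_coeffs d s f \<alpha>"
    and s: "\<And>n. s n \<noteq> 0" and N: "d \<le> N"
  shows "window d f (N + j) z =
    ladder_prod (d + 1) (\<lambda>n. shift_mat d s \<alpha> n z) N j *\<^sub>v window d f N z"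
proof (induction j)
  case 0
  show ?case using window_carrier[of d f N z] by simp
next
  case (Suc j)
  let ?L = "ladder_prod (d + 1) (\<lambda>n. shift_mat d s \<alpha> n z) N j"
  have "window d f (N + Suc j) z = shift_mat d s \<alpha> (N + j) z *\<^sub>v window d f (N + j) z"
    using shift_mat_mult_window[OF rec s, of "N + j"] N by simp
  also have "\<dots> = shift_mat d s \<alpha> (N + j) z *\<^sub>v (?L *\<^sub>v window d f N z)"
    by (simp only: Suc.IH)
  also have "\<dots> = (shift_mat d s \<alpha> (N + j) z * ?L) *\<^sub>v window d f N z"
    by (rule assoc_mult_mat_vec[symmetric,
          OF shift_mat_carrier ladder_prod_carrier[OF shift_mat_carrier] window_carrier])
  finally show ?case by simp
qed

theorem lemma2p3:
  fixes d1 d2 :: nat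
    and u v :: "nat \<Rightarrow> complex"
    and gx gy :: "real \<Rightarrow> complex"
    and p q :: "nat \<Rightarrow> complex poly"
    and h s :: "nat \<Rightarrow> complex"
    and \<alpha> \<beta> :: "nat \<Rightarrow> nat \<Rightarrow> complex"
    and \<psi> \<phi> :: "nat \<Rightarrow> complex \<Rightarrow> complex"
  defines "\<psi> \<equiv> quasi_poly d1 u p s"
    and "\<phi> \<equiv> quasi_poly d2 v q s"
  assumes "d1 \<ge> 1" and "d2 \<ge> 1"
    and "u (d1 + 1) \<noteq> 0" and "v (d2 + 1) \<noteq> 0"
    and "admissible_contours d1 d2 u v gx gy"
    and "monic_sequence p" and "monic_sequence q"
    and "biorthogonal d1 d2 u v gx gy p q h"
    and "\<And>n. h n \<noteq> 0"
    and "\<And>n. (s n)\<^sup>2 = h n"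
    and "recurrence_coeffs d2 s \<psi> \<alpha>"
    and "recurrence_coeffs d1 s \<phi> \<beta>"
  shows
    "(\<forall>N\<ge>d2. \<forall>x. shift_mat d2 s \<alpha> N x *\<^sub>v window d2 \<psi> N x = window d2 \<psi> (N + 1) x) \<and>
     (\<forall>N\<ge>d1. \<forall>y. shift_mat d1 s \<beta> N y *\<^sub>v window d1 \<phi> N y = window d1 \<phi> (N + 1) y) \<and>
     (\<forall>N\<ge>d2. \<forall>j\<ge>1. \<forall>x. window d2 \<psi> (N + j) x =
        ladder_prod (d2 + 1) (\<lambda>n. shift_mat d2 s \<alpha> n x) N j *\<^sub>v window d2 \<psi> N x) \<and>
     (\<forall>N\<ge>d1. \<forall>j\<ge>1. \<forall>y. window d1 \<phi> (N + j) y =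
        ladder_prod (d1 + 1) (\<lambda>n. shift_mat d1 s \<beta> n y) N j *\<^sub>v window d1 \<phi> N y)"
proof -
  \<comment> \<open>A square root of the nonzero \<open>h n\<close> is nonzero, so every
    \<open>gamma_coeff s n\<close> is too.\<close>
  have s: "s n \<noteq> 0" for n
    using \<open>h n \<noteq> 0\<close> \<open>(s n)\<^sup>2 = h n\<close> by auto
  note rec = \<open>recurrence_coeffs d2 s \<psi> \<alpha>\<close> \<open>recurrence_coeffs d1 s \<phi> \<beta>\<close>
  show ?thesis
    \<comment> \<open>The general lemmas are used with \<open>d = d2\<close> for
      \<open>\<psi>\<close> and \<open>d = d1\<close> for \<open>\<phi>\<close>.\<close>
    using shift_mat_mult_window[OF rec(1) s] shift_mat_mult_window[OF rec(2) s]
      window_add_eq_ladder_prod[OF rec(1) s] window_add_eq_ladder_prod[OF rec(2) s]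
    by (simp del: ladder_prod.simps)
qed

end
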